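(* Let $f_1,f_2,f_3:T^2\to S^1$ be maps from the 2-torus to the circle and let $\phi_1,\phi_2,\phi_3:\pi_1(T^2)\to\pi_1(S^1)$ be the induced homomorphisms. If $R(\phi_1,\phi_2,\phi_3)<\infty$, then $R(\phi_1,\phi_2)<\infty$, $R(\phi_1,\phi_3)<\infty$, and the product $R(\phi_1,\phi_2)\cdot R(\phi_1,\phi_3)$ divides $R(\phi_1,\phi_2,\phi_3)$.
   Context: For group homomorphisms $\phi_1,\dots,\phi_k:G\to H$ ($k\ge2$), put on $H^{k-1}$ the equivalence relation $(\alpha_2,\dots,\alpha_k)\sim(\beta_2,\dots,\beta_k)$ iff there is $z\in G$ with $\beta_i=\phi_1(z)\alpha_i\phi_i(z)^{-1}$ for all $i=2,\dots,k$. The Reidemeister number $R(\phi_1,\dots,\phi_k)$ is the cardinality of the set of equivalence classes. *)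

theory Defs
  imports "HOL-Analysis.Analysis" "HOL-Algebra.Group"
begin

definition loops_at :: "'a::topological_space set \<Rightarrow> 'a \<Rightarrow> (real \<Rightarrow> 'a) set" where
  "loops_at S x = {p. path p \<and> path_image p \<subseteq> S \<and> pathstart p = x \<and> pathfinish p = x}"

definition path_class :: "'a::topological_space set \<Rightarrow> (real \<Rightarrow> 'a) \<Rightarrow> (real \<Rightarrow> 'a) set" where
  "path_class S p = {q. homotopic_paths S p q}"

definition fundamental_group ::
    "'a::topological_space set \<Rightarrow> 'a \<Rightarrow> (real \<Rightarrow> 'a) set monoid" where
  "fundamental_group S x =
     \<lparr>carrier = path_class S ` loops_at S x,
      monoid.mult = (\<lambda>A B. \<Union>p\<in>A. \<Union>q\<in>B. path_class S (p +++ q)),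
      one = path_class S (\<lambda>_. x)\<rparr>"

lemma path_class_eqI: "homotopic_paths S p q \<Longrightarrow> path_class S p = path_class S q"
  unfolding path_class_def
  by (rule Collect_cong) (metis homotopic_paths_trans homotopic_paths_sym)

lemma path_class_eq_iff:
  "p \<in> loops_at S x \<Longrightarrow> path_class S p = path_class S q \<longleftrightarrow> homotopic_paths S p q"
proof
  assume p: "p \<in> loops_at S x" and eq: "path_class S p = path_class S q"
  have "p \<in> path_class S p"
    using p by (simp add: path_class_def loops_at_def)
  then have "homotopic_paths S q p"
    unfolding eq by (simp add: path_class_def)
  then show "homotopic_paths S p q"
    by (rule homotopic_paths_sym)
qed (rule path_class_eqI)

lemma carrier_fundamental_group:
  "carrier (fundamental_group S x) = path_class S ` loops_at S x"
  by (simp add: fundamental_group_def)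

lemma one_fundamental_group: "\<one>\<^bsub>fundamental_group S x\<^esub> = path_class S (\<lambda>_. x)"
  by (simp add: fundamental_group_def)

lemma loops_at_join: "p \<in> loops_at S x \<Longrightarrow> q \<in> loops_at S x \<Longrightarrow> p +++ q \<in> loops_at S x"
  by (simp add: loops_at_def path_image_join)

lemma UN_const_eqI: "a \<in> A \<Longrightarrow> (\<And>x. x \<in> A \<Longrightarrow> f x = C) \<Longrightarrow> (\<Union>x\<in>A. f x) = C"
  by auto

lemma mult_fundamental_group:
  assumes "p \<in> loops_at S x" "q \<in> loops_at S x"
  shows "path_class S p \<otimes>\<^bsub>fundamental_group S x\<^esub> path_class S q = path_class S (p +++ q)"
proof -
  have *: "path_class S (p' +++ q') = path_class S (p +++ q)"
    if "p' \<in> path_class S p" "q' \<in> path_class S q" for p' q'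
    using that assms
    by (intro path_class_eqI[symmetric] homotopic_paths_join) (auto simp: path_class_def loops_at_def)
  have "p \<in> path_class S p" "q \<in> path_class S q"
    using assms by (auto simp: path_class_def loops_at_def)
  then have "(\<Union>p'\<in>path_class S p. \<Union>q'\<in>path_class S q. path_class S (p' +++ q')) =
      path_class S (p +++ q)"
    by (intro UN_const_eqI *)
  then show ?thesis
    by (simp add: fundamental_group_def)
qed

lemma group_fundamental_group:
  fixes S :: "'a::real_normed_vector set"
  assumes "x \<in> S"
  shows "group (fundamental_group S x)"
proof (rule groupI)
  have c: "(\<lambda>_. x) \<in> loops_at S x"
    using assms by (auto simp: loops_at_def path_image_def pathstart_def pathfinish_def path_def)
  show "\<one>\<^bsub>fundamental_group S x\<^esub> \<in> carrier (fundamental_group S x)"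
    using c by (simp add: carrier_fundamental_group one_fundamental_group)
  fix A B C
  assume "A \<in> carrier (fundamental_group S x)" "B \<in> carrier (fundamental_group S x)"
    "C \<in> carrier (fundamental_group S x)"
  then obtain p q r where A: "A = path_class S p" and B: "B = path_class S q"
    and C: "C = path_class S r"
    and pqr: "p \<in> loops_at S x" "q \<in> loops_at S x" "r \<in> loops_at S x"
    by (auto simp: carrier_fundamental_group)
  show "A \<otimes>\<^bsub>fundamental_group S x\<^esub> B \<in> carrier (fundamental_group S x)"
    using pqr by (auto simp: A B mult_fundamental_group carrier_fundamental_group loops_at_join)
  show "A \<otimes>\<^bsub>fundamental_group S x\<^esub> B \<otimes>\<^bsub>fundamental_group S x\<^esub> C =
        A \<otimes>\<^bsub>fundamental_group S x\<^esub> (B \<otimes>\<^bsub>fundamental_group S x\<^esub> C)"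
    using pqr unfolding A B C
    by (simp add: mult_fundamental_group loops_at_join)
       (intro path_class_eqI[symmetric] homotopic_paths_assoc; simp add: loops_at_def)
  have "homotopic_paths S (linepath x x +++ p) p"
    using pqr(1) by (intro homotopic_paths_lid') (auto simp: loops_at_def)
  then show "\<one>\<^bsub>fundamental_group S x\<^esub> \<otimes>\<^bsub>fundamental_group S x\<^esub> A = A"
    using pqr(1) c unfolding A one_fundamental_group
    by (simp add: mult_fundamental_group) (intro path_class_eqI, simp add: linepath_refl)
  have r: "reversepath p \<in> loops_at S x"
    using pqr(1) by (auto simp: loops_at_def)
  have "homotopic_paths S (reversepath p +++ p) (linepath x x)"
    using pqr(1) homotopic_paths_linv[of p S] by (auto simp: loops_at_def)
  then have "path_class S (reversepath p) \<otimes>\<^bsub>fundamental_group S x\<^esub> A = \<one>\<^bsub>fundamental_group S x\<^esub>"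
    using pqr(1) r unfolding A one_fundamental_group
    by (simp add: mult_fundamental_group) (intro path_class_eqI, simp add: linepath_refl)
  then show "\<exists>B\<in>carrier (fundamental_group S x).
      B \<otimes>\<^bsub>fundamental_group S x\<^esub> A = \<one>\<^bsub>fundamental_group S x\<^esub>"
    using r by (auto simp: carrier_fundamental_group)
qed

text \<open>
  A map \<open>f\<close> from \<open>S\<close> to \<open>T\<close> need not respect chosen base points \<open>x\<close> and \<open>y\<close>, so the
  homomorphism it induces from \<open>fundamental_group S x\<close> to \<open>fundamental_group T y\<close> depends on a
  path \<open>w\<close> in \<open>T\<close> from \<open>y\<close> to \<open>f x\<close>. It is independent of \<open>w\<close> up to conjugation in
  \<open>fundamental_group T y\<close>, hence independent of \<open>w\<close> if that group is abelian.
\<close>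

definition induced_hom ::
    "'b::topological_space set \<Rightarrow> (real \<Rightarrow> 'b) \<Rightarrow> ('a::topological_space \<Rightarrow> 'b) \<Rightarrow>
     (real \<Rightarrow> 'a) set \<Rightarrow> (real \<Rightarrow> 'b) set" where
  "induced_hom T w f A = (\<Union>p\<in>A. path_class T (w +++ ((f \<circ> p) +++ reversepath w)))"

lemma induced_hom_path_class:
  assumes f: "continuous_on S f" "f \<in> S \<rightarrow> T"
    and w: "path w" "path_image w \<subseteq> T" "pathfinish w = f x"
    and p: "p \<in> loops_at S x"
  shows "induced_hom T w f (path_class S p) =
         path_class T (w +++ ((f \<circ> p) +++ reversepath w))"
proof -
  have *: "path_class T (w +++ ((f \<circ> p') +++ reversepath w)) =
        path_class T (w +++ ((f \<circ> p) +++ reversepath w))" if "p' \<in> path_class S p" for p'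
  proof -
    have h: "homotopic_paths S p p'"
      using that by (simp add: path_class_def)
    have "pathstart p' = x" "pathfinish p' = x"
      using p homotopic_paths_imp_pathstart[OF h] homotopic_paths_imp_pathfinish[OF h]
      by (auto simp: loops_at_def)
    then show ?thesis
      using p w homotopic_paths_continuous_image[OF h f]
      by (intro path_class_eqI[symmetric] homotopic_paths_join)
         (auto simp: loops_at_def pathstart_compose pathfinish_compose)
  qed
  have "p \<in> path_class S p"
    using p by (auto simp: path_class_def loops_at_def)
  then show ?thesis
    unfolding induced_hom_def by (rule UN_const_eqI) (rule *)
qed

lemma induced_hom_in_hom:
  fixes T :: "'b::real_normed_vector set"
  assumes f: "continuous_on S f" "f \<in> S \<rightarrow> T"
    and w: "path w" "path_image w \<subseteq> T" "pathstart w = y" "pathfinish w = f x"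
  shows "induced_hom T w f \<in> hom (fundamental_group S x) (fundamental_group T y)"
proof (rule homI)
  define c where "c p = w +++ ((f \<circ> p) +++ reversepath w)" for p
  have fl: "f \<circ> p \<in> loops_at T (f x)" if "p \<in> loops_at S x" for p
  proof -
    have "path p" "path_image p \<subseteq> S"
      using that by (simp_all add: loops_at_def)
    then have "path (f \<circ> p)" "path_image (f \<circ> p) \<subseteq> T"
      using path_continuous_image[OF _ continuous_on_subset[OF f(1)]] f(2)
      by (simp, auto simp: path_image_compose)
    then show ?thesis
      using that by (simp add: loops_at_def pathstart_compose pathfinish_compose)
  qed
  have cl: "c p \<in> loops_at T y" if "p \<in> loops_at S x" for p
    using fl[OF that] w by (auto simp: c_def loops_at_def path_image_join)
  note ih = induced_hom_path_class[OF f w(1,2,4), folded c_def]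
  fix A B
  assume "A \<in> carrier (fundamental_group S x)"
  then obtain p where A: "A = path_class S p" and p: "p \<in> loops_at S x"
    by (auto simp: carrier_fundamental_group)
  show "induced_hom T w f A \<in> carrier (fundamental_group T y)"
    using p cl by (simp add: A ih carrier_fundamental_group)
  assume "B \<in> carrier (fundamental_group S x)"
  then obtain q where B: "B = path_class S q" and q: "q \<in> loops_at S x"
    by (auto simp: carrier_fundamental_group)
  have fp: "path (f \<circ> p)" "path_image (f \<circ> p) \<subseteq> T" "pathstart (f \<circ> p) = f x" "pathfinish (f \<circ> p) = f x"
    and fq: "path (f \<circ> q)" "path_image (f \<circ> q) \<subseteq> T" "pathstart (f \<circ> q) = f x" "pathfinish (f \<circ> q) = f x"
    using fl p q by (auto simp: loops_at_def)
  define v where "v = reversepath w"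
  have v: "path v" "path_image v \<subseteq> T" "pathstart v = f x" "pathfinish v = y"
    using w by (auto simp: v_def)
  let ?P = "f \<circ> p" and ?Q = "f \<circ> q"
  note facts = fp fq v w path_image_join
  have 1: "homotopic_paths T (c p +++ c q) (w +++ ((?P +++ v) +++ (w +++ (?Q +++ v))))"
    unfolding c_def v_def[symmetric]
    by (rule homotopic_paths_sym, rule homotopic_paths_assoc) (simp_all add: facts)
  have 2: "homotopic_paths T ((?P +++ v) +++ (w +++ (?Q +++ v))) (?P +++ (v +++ (w +++ (?Q +++ v))))"
    by (rule homotopic_paths_sym, rule homotopic_paths_assoc) (simp_all add: facts)
  have 3: "homotopic_paths T (v +++ (w +++ (?Q +++ v))) ((v +++ w) +++ (?Q +++ v))"
    by (rule homotopic_paths_assoc) (simp_all add: facts)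
  have 4: "homotopic_paths T ((v +++ w) +++ (?Q +++ v)) (linepath (f x) (f x) +++ (?Q +++ v))"
    using homotopic_paths_linv[of w T]
    by (intro homotopic_paths_join) (simp_all add: facts v_def[symmetric])
  have 5: "homotopic_paths T (linepath (f x) (f x) +++ (?Q +++ v)) (?Q +++ v)"
    by (rule homotopic_paths_lid') (simp_all add: facts)
  have 6: "homotopic_paths T (v +++ (w +++ (?Q +++ v))) (?Q +++ v)"
    using 3 4 5 homotopic_paths_trans by blast
  have 7: "homotopic_paths T (?P +++ (v +++ (w +++ (?Q +++ v)))) (?P +++ (?Q +++ v))"
    by (rule homotopic_paths_join[OF _ 6]) (simp_all add: facts)
  have 8: "homotopic_paths T (?P +++ (?Q +++ v)) ((?P +++ ?Q) +++ v)"
    by (rule homotopic_paths_assoc) (simp_all add: facts)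
  have "homotopic_paths T ((?P +++ v) +++ (w +++ (?Q +++ v))) ((?P +++ ?Q) +++ v)"
    using 2 7 8 homotopic_paths_trans by blast
  then have "homotopic_paths T (w +++ ((?P +++ v) +++ (w +++ (?Q +++ v)))) (w +++ ((?P +++ ?Q) +++ v))"
    by (rule homotopic_paths_join[rotated]) (simp_all add: facts)
  then have "homotopic_paths T (c p +++ c q) (c (p +++ q))"
    using homotopic_paths_trans[OF 1] by (simp add: c_def v_def path_compose_join)
  note path_class_eqI[OF this]
  then show "induced_hom T w f (A \<otimes>\<^bsub>fundamental_group S x\<^esub> B) =
      induced_hom T w f A \<otimes>\<^bsub>fundamental_group T y\<^esub> induced_hom T w f B"
    using p q cl by (simp add: A B ih mult_fundamental_group loops_at_join)
qed

text \<open>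
  Lists are indexed from 0: \<open>\<phi>s ! 0\<close> is \<open>\<phi>\<^sub>1\<close>, and position \<open>i\<close> of a tuple
  \<open>(\<alpha>\<^sub>2, \<dots>, \<alpha>\<^sub>k)\<close> holds \<open>\<alpha>\<^sub>i\<^sub>+\<^sub>2\<close>, which is paired with
  \<open>\<phi>s ! Suc i\<close>.
\<close>

definition reidemeister_tuples :: "('b, 'n) monoid_scheme \<Rightarrow> ('a \<Rightarrow> 'b) list \<Rightarrow> 'b list set" where
  "reidemeister_tuples H \<phi>s = {\<alpha>. length \<alpha> = length \<phi>s - 1 \<and> set \<alpha> \<subseteq> carrier H}"

definition reidemeister_rel ::
    "('a, 'm) monoid_scheme \<Rightarrow> ('b, 'n) monoid_scheme \<Rightarrow> ('a \<Rightarrow> 'b) list \<Rightarrow>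
     ('b list \<times> 'b list) set" where
  "reidemeister_rel G H \<phi>s =
     {(\<alpha>, \<beta>). \<alpha> \<in> reidemeister_tuples H \<phi>s \<and> \<beta> \<in> reidemeister_tuples H \<phi>s \<and>
        (\<exists>z\<in>carrier G. \<forall>i<length \<phi>s - 1.
           \<beta> ! i = (\<phi>s ! 0) z \<otimes>\<^bsub>H\<^esub> \<alpha> ! i \<otimes>\<^bsub>H\<^esub> inv\<^bsub>H\<^esub> ((\<phi>s ! Suc i) z))}"

lemma equiv_reidemeister_rel:
  assumes G: "group G" and H: "group H" and hom: "set \<phi>s \<subseteq> hom G H" and ne: "\<phi>s \<noteq> []"
  shows "equiv (reidemeister_tuples H \<phi>s) (reidemeister_rel G H \<phi>s)"
proof -
  interpret G: group G by fact
  interpret H: group H by fact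
  have gh: "group_hom G H (\<phi>s ! i)" if "i < length \<phi>s" for i
    using that hom G H by (auto simp: group_hom_def group_hom_axioms_def)
  have cl: "(\<phi>s ! i) z \<in> carrier H" if "i < length \<phi>s" "z \<in> carrier G" for i z
    using that group_hom.hom_closed[OF gh] by blast
  have mu: "(\<phi>s ! i) (y \<otimes>\<^bsub>G\<^esub> z) = (\<phi>s ! i) y \<otimes>\<^bsub>H\<^esub> (\<phi>s ! i) z"
    if "i < length \<phi>s" "y \<in> carrier G" "z \<in> carrier G" for i y z
    using that group_hom.hom_mult[OF gh] by blast
  have iv: "(\<phi>s ! i) (inv\<^bsub>G\<^esub> z) = inv\<^bsub>H\<^esub> (\<phi>s ! i) z" if "i < length \<phi>s" "z \<in> carrier G" for i z
    using that group_hom.hom_inv[OF gh] by blast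
  have on: "(\<phi>s ! i) \<one>\<^bsub>G\<^esub> = \<one>\<^bsub>H\<^esub>" if "i < length \<phi>s" for i
    using that group_hom.hom_one[OF gh] by blast
  have n: "0 < length \<phi>s" "\<And>i. i < length \<phi>s - 1 \<Longrightarrow> Suc i < length \<phi>s"
    using ne by auto
  have tc: "\<alpha> ! i \<in> carrier H" if "\<alpha> \<in> reidemeister_tuples H \<phi>s" "i < length \<phi>s - 1" for \<alpha> i
    using that nth_mem[of i \<alpha>] by (auto simp: reidemeister_tuples_def)
  have s: "inv\<^bsub>H\<^esub> a \<otimes>\<^bsub>H\<^esub> (a \<otimes>\<^bsub>H\<^esub> b \<otimes>\<^bsub>H\<^esub> inv\<^bsub>H\<^esub> c) \<otimes>\<^bsub>H\<^esub> c = b"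
    if "a \<in> carrier H" "b \<in> carrier H" "c \<in> carrier H" for a b c
  proof -
    have "inv\<^bsub>H\<^esub> a \<otimes>\<^bsub>H\<^esub> (a \<otimes>\<^bsub>H\<^esub> (b \<otimes>\<^bsub>H\<^esub> inv\<^bsub>H\<^esub> c)) = b \<otimes>\<^bsub>H\<^esub> inv\<^bsub>H\<^esub> c"
      using that by (subst H.m_assoc[symmetric]) auto
    then show ?thesis
      using that by (simp add: H.m_assoc)
  qed
  show ?thesis
  proof (rule equivI)
    show "reidemeister_rel G H \<phi>s \<subseteq> reidemeister_tuples H \<phi>s \<times> reidemeister_tuples H \<phi>s"
      by (auto simp: reidemeister_rel_def)
    show "refl_on (reidemeister_tuples H \<phi>s) (reidemeister_rel G H \<phi>s)"
      using n tc by (auto simp: refl_on_def reidemeister_rel_def on intro!: bexI[of _ "\<one>\<^bsub>G\<^esub>"])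
    show "sym (reidemeister_rel G H \<phi>s)"
    proof (rule symI)
      fix \<alpha> \<beta> assume "(\<alpha>, \<beta>) \<in> reidemeister_rel G H \<phi>s"
      then obtain z where z: "z \<in> carrier G" and t: "\<alpha> \<in> reidemeister_tuples H \<phi>s"
        "\<beta> \<in> reidemeister_tuples H \<phi>s"
        and e: "\<And>i. i < length \<phi>s - 1 \<Longrightarrow>
          \<beta> ! i = (\<phi>s ! 0) z \<otimes>\<^bsub>H\<^esub> \<alpha> ! i \<otimes>\<^bsub>H\<^esub> inv\<^bsub>H\<^esub> ((\<phi>s ! Suc i) z)"
        by (auto simp: reidemeister_rel_def)
      have "\<alpha> ! i = (\<phi>s ! 0) (inv\<^bsub>G\<^esub> z) \<otimes>\<^bsub>H\<^esub> \<beta> ! i \<otimes>\<^bsub>H\<^esub> inv\<^bsub>H\<^esub> ((\<phi>s ! Suc i) (inv\<^bsub>G\<^esub> z))"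
        if i: "i < length \<phi>s - 1" for i
        using z tc[OF t(1) i] cl[OF n(1) z] cl[OF n(2)[OF i] z]
        by (simp add: e[OF i] iv[OF n(1)] iv[OF n(2)[OF i]] s)
      then show "(\<beta>, \<alpha>) \<in> reidemeister_rel G H \<phi>s"
        using t z by (auto simp: reidemeister_rel_def intro!: bexI[of _ "inv\<^bsub>G\<^esub> z"])
    qed
    show "trans (reidemeister_rel G H \<phi>s)"
    proof (rule transI)
      fix \<alpha> \<beta> \<gamma>
      assume "(\<alpha>, \<beta>) \<in> reidemeister_rel G H \<phi>s" "(\<beta>, \<gamma>) \<in> reidemeister_rel G H \<phi>s"
      then obtain z y where zy: "z \<in> carrier G" "y \<in> carrier G"
        and t: "\<alpha> \<in> reidemeister_tuples H \<phi>s" "\<gamma> \<in> reidemeister_tuples H \<phi>s"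
        and e: "\<And>i. i < length \<phi>s - 1 \<Longrightarrow>
          \<beta> ! i = (\<phi>s ! 0) z \<otimes>\<^bsub>H\<^esub> \<alpha> ! i \<otimes>\<^bsub>H\<^esub> inv\<^bsub>H\<^esub> ((\<phi>s ! Suc i) z)"
          "\<And>i. i < length \<phi>s - 1 \<Longrightarrow>
          \<gamma> ! i = (\<phi>s ! 0) y \<otimes>\<^bsub>H\<^esub> \<beta> ! i \<otimes>\<^bsub>H\<^esub> inv\<^bsub>H\<^esub> ((\<phi>s ! Suc i) y)"
        by (auto simp: reidemeister_rel_def)
      have "\<gamma> ! i = (\<phi>s ! 0) (y \<otimes>\<^bsub>G\<^esub> z) \<otimes>\<^bsub>H\<^esub> \<alpha> ! i \<otimes>\<^bsub>H\<^esub> inv\<^bsub>H\<^esub> ((\<phi>s ! Suc i) (y \<otimes>\<^bsub>G\<^esub> z))"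
        if i: "i < length \<phi>s - 1" for i
        using zy tc[OF t(1) i] cl[OF n(1)] cl[OF n(2)[OF i]]
        by (simp add: e[OF i] mu[OF n(1)] mu[OF n(2)[OF i]] H.m_assoc H.inv_mult_group)
      then show "(\<alpha>, \<gamma>) \<in> reidemeister_rel G H \<phi>s"
        using t zy by (auto simp: reidemeister_rel_def intro!: bexI[of _ "y \<otimes>\<^bsub>G\<^esub> z"])
    qed
  qed
qed

definition reidemeister_classes ::
    "('a, 'm) monoid_scheme \<Rightarrow> ('b, 'n) monoid_scheme \<Rightarrow> ('a \<Rightarrow> 'b) list \<Rightarrow> 'b list set set" where
  "reidemeister_classes G H \<phi>s = reidemeister_tuples H \<phi>s // reidemeister_rel G H \<phi>s"

text \<open>
  Since \<^const>\<open>card\<close> of an infinite set is 0, finiteness of the Reidemeister number has to be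
  expressed as finiteness of \<^const>\<open>reidemeister_classes\<close>.
\<close>

definition reidemeister_number ::
    "('a, 'm) monoid_scheme \<Rightarrow> ('b, 'n) monoid_scheme \<Rightarrow> ('a \<Rightarrow> 'b) list \<Rightarrow> nat" where
  "reidemeister_number G H \<phi>s = card (reidemeister_classes G H \<phi>s)"

abbreviation circle :: "complex set" where
  "circle \<equiv> sphere 0 1"

abbreviation torus :: "(complex \<times> complex) set" where
  "torus \<equiv> circle \<times> circle"

end

theory Submission
  imports Defs
begin

text \<open>
  For loops \<open>p\<close> and \<open>q\<close> at \<open>y\<close> in the circle, \<open>(s, t) \<mapsto> p s * q t / y\<close> maps the unit square
  to the circle, with \<open>p\<close> then \<open>q\<close> along one half of the boundary and \<open>q\<close> then \<open>p\<close> along the other.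
  Hence the fundamental group \<open>H\<close> of the circle is abelian, so translating both coordinates acts
  transitively on the classes of \<open>(\<phi>\<^sub>1, \<phi>\<^sub>2, \<phi>\<^sub>3)\<close> and on pairs of classes of
  \<open>(\<phi>\<^sub>1, \<phi>\<^sub>2)\<close> and \<open>(\<phi>\<^sub>1, \<phi>\<^sub>3)\<close>. The coordinate projections give an equivariant surjection
  of the former onto the latter. Its fibres therefore all have the same cardinality, which is
  the required cofactor.
\<close>

lemma homotopic_paths_join_commute:
  fixes p q :: "real \<Rightarrow> 'a::real_normed_field"
  assumes p: "p \<in> loops_at (sphere 0 1) y" and q: "q \<in> loops_at (sphere 0 1) y"
  shows "homotopic_paths (sphere 0 1) (p +++ q) (q +++ p)"
proof -
  \<comment> \<open>Since \<open>p\<close> and \<open>q\<close> both take the value \<open>y\<close>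
    at 0 and 1, dividing by \<open>y\<close> makes \<open>h\<close> restrict to \<open>p\<close> on
    the horizontal edges and to \<open>q\<close> on the vertical ones.\<close>
  define h where "h = (\<lambda>(s, t). p s * q t / y)"
  define S :: "(real \<times> real) set" where "S = {0..1} \<times> {0..1}"
  have pq: "continuous_on {0..1} p" "continuous_on {0..1} q"
      "p 0 = y" "p 1 = y" "q 0 = y" "q 1 = y"
      "\<And>t. t \<in> {0..1} \<Longrightarrow> norm (p t) = 1" "\<And>t. t \<in> {0..1} \<Longrightarrow> norm (q t) = 1"
    using p q by (auto simp: loops_at_def path_def path_image_def pathstart_def pathfinish_def
        image_subset_iff)
  have ny: "norm y = 1" using pq(3) pq(7)[of 0] by simp
  then have y: "y \<noteq> 0" by auto
  have h: "continuous_on S h" "h \<in> S \<rightarrow> sphere 0 1"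
  proof -
    have "continuous_on S (\<lambda>x. p (fst x) * q (snd x) / y)"
      using y by (intro continuous_intros continuous_on_compose2[OF pq(1)]
          continuous_on_compose2[OF pq(2)]) (auto simp: S_def)
    then show "continuous_on S h" by (simp add: h_def case_prod_unfold)
    show "h \<in> S \<rightarrow> sphere 0 1"
      using pq(7,8) ny by (auto simp: S_def h_def norm_mult norm_divide)
  qed
  \<comment> \<open>\<open>u\<close> follows the bottom and right edges, \<open>v\<close> the left
    and top ones. They share endpoints in a convex set, hence are homotopic.\<close>
  define u v :: "real \<Rightarrow> real \<times> real"
    where "u = linepath (0, 0) (1, 0) +++ linepath (1, 0) (1, 1)"
      and "v = linepath (0, 0) (0, 1) +++ linepath (0, 1) (1, 1)"
  have cS: "convex S" by (simp add: S_def convex_Times)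
  have "homotopic_paths S u v"
  proof -
    have "closed_segment a b \<subseteq> S" if "a \<in> S" "b \<in> S" for a b
      using that cS by (rule closed_segment_subset)
    then have "path_image u \<subseteq> S" "path_image v \<subseteq> S"
      by (simp_all add: u_def v_def path_image_join) (simp_all add: S_def)
    then show ?thesis
      using convex_imp_simply_connected[OF cS]
      by (simp add: simply_connected_eq_homotopic_paths u_def v_def)
  qed
  then have "homotopic_paths (sphere 0 1) (h \<circ> u) (h \<circ> v)"
    using h by (rule homotopic_paths_continuous_image)
  moreover have "h \<circ> u = p +++ q" "h \<circ> v = q +++ p"
    using y pq by (auto simp: fun_eq_iff h_def u_def v_def joinpaths_def linepath_def)
  ultimately show ?thesis by simp
qed

lemma comm_group_fundamental_group_sphere:
  fixes y :: "'a::real_normed_field"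
  assumes "y \<in> sphere 0 1"
  shows "comm_group (fundamental_group (sphere 0 1) y)"
proof (rule group.group_comm_groupI[OF group_fundamental_group[OF assms]])
  fix A B
  assume "A \<in> carrier (fundamental_group (sphere 0 1) y)"
    and "B \<in> carrier (fundamental_group (sphere 0 1) y)"
  then obtain p q where "A = path_class (sphere 0 1) p" "B = path_class (sphere 0 1) q"
    "p \<in> loops_at (sphere 0 1) y" "q \<in> loops_at (sphere 0 1) y"
    by (auto simp: carrier_fundamental_group)
  then show "A \<otimes>\<^bsub>fundamental_group (sphere 0 1) y\<^esub> B = B \<otimes>\<^bsub>fundamental_group (sphere 0 1) y\<^esub> A"
    by (simp add: mult_fundamental_group homotopic_paths_join_commute path_class_eqI)
qed

text \<open>\<open>card A\<close> is the sum of the fibre sizes. As \<open>le\<close> ranges over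
  ordered pairs, antisymmetry makes these equal, so injections between fibres suffice to apply
  this.\<close>

lemma card_dvd_card_if_fibres_le:
  assumes fin: "finite A" and surj: "f ` A = B"
    and le: "\<And>b b'. b \<in> B \<Longrightarrow> b' \<in> B \<Longrightarrow> card {x \<in> A. f x = b} \<le> card {x \<in> A. f x = b'}"
  shows "card B dvd card A"
proof (cases "B = {}")
  case False
  then obtain b where b: "b \<in> B" by blast
  have "card A = (\<Sum>b'\<in>B. card {x \<in> A. f x = b'})"
    using fin surj sum.group[of A B f "\<lambda>_. 1 :: nat"] by auto
  also have "\<dots> = (\<Sum>b'\<in>B. card {x \<in> A. f x = b})"
    using b le by (intro sum.cong refl antisym) auto
  finally show ?thesis by simp
qed (use surj in simp)

text \<open>Classes as explicit images of \<open>carrier G\<close>, so that maps applied to them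
  elementwise can be computed by composing images.\<close>

definition orbit2 where
  "orbit2 G H \<phi> \<psi> a = (\<lambda>z. [\<phi> z \<otimes>\<^bsub>H\<^esub> a \<otimes>\<^bsub>H\<^esub> inv\<^bsub>H\<^esub> (\<psi> z)]) ` carrier G"

definition orbit3 where
  "orbit3 G H \<phi> \<psi> \<theta> = (\<lambda>(a, b). (\<lambda>z. [\<phi> z \<otimes>\<^bsub>H\<^esub> a \<otimes>\<^bsub>H\<^esub> inv\<^bsub>H\<^esub> (\<psi> z),
     \<phi> z \<otimes>\<^bsub>H\<^esub> b \<otimes>\<^bsub>H\<^esub> inv\<^bsub>H\<^esub> (\<theta> z)]) ` carrier G)"

text \<open>Closure of \<open>H\<close> makes every twisted \<open>a\<close> a valid tuple again, so
  the relation image of \<open>[a]\<close> is the whole orbit.\<close>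

lemma reidemeister_classes_two:
  assumes "group H" "\<phi> \<in> carrier G \<rightarrow> carrier H" "\<psi> \<in> carrier G \<rightarrow> carrier H"
  shows "reidemeister_classes G H [\<phi>, \<psi>] = orbit2 G H \<phi> \<psi> ` carrier H"
proof -
  interpret group H by fact
  have "reidemeister_tuples H [\<phi>, \<psi>] = (\<lambda>a. [a]) ` carrier H"
    by (auto simp: reidemeister_tuples_def length_Suc_conv)
  moreover have "reidemeister_rel G H [\<phi>, \<psi>] `` {[a]} = orbit2 G H \<phi> \<psi> a" if "a \<in> carrier H" for a
    using that assms
    by (auto simp: reidemeister_rel_def reidemeister_tuples_def orbit2_def length_Suc_conv Pi_iff)
  ultimately show ?thesis
    by (auto simp: reidemeister_classes_def quotient_def)
qed

lemma reidemeister_classes_three: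
  assumes "group H" "\<phi> \<in> carrier G \<rightarrow> carrier H" "\<psi> \<in> carrier G \<rightarrow> carrier H"
    "\<theta> \<in> carrier G \<rightarrow> carrier H"
  shows "reidemeister_classes G H [\<phi>, \<psi>, \<theta>] = orbit3 G H \<phi> \<psi> \<theta> ` (carrier H \<times> carrier H)"
proof -
  interpret group H by fact
  have "reidemeister_tuples H [\<phi>, \<psi>, \<theta>] = (\<lambda>(a, b). [a, b]) ` (carrier H \<times> carrier H)"
    by (auto simp: reidemeister_tuples_def length_Suc_conv image_iff)
  moreover have "reidemeister_rel G H [\<phi>, \<psi>, \<theta>] `` {[a, b]} = orbit3 G H \<phi> \<psi> \<theta> (a, b)"
    if "a \<in> carrier H" "b \<in> carrier H" for a b
    \<comment> \<open>The quantifier over \<open>i < 2\<close> splits into one equation per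
      coordinate, with a common \<open>z\<close>.\<close>
    using that assms
    by (auto simp: reidemeister_rel_def reidemeister_tuples_def orbit3_def length_Suc_conv
        less_Suc_eq Pi_iff numeral_2_eq_2 all_conj_distrib)
  ultimately show ?thesis
    by (auto simp: reidemeister_classes_def quotient_def UNION_singleton_eq_range image_image
        intro!: image_cong)
qed

lemma reidemeister_number_three:
  fixes G :: "('a, 'm) monoid_scheme" and H :: "('b, 'n) monoid_scheme"
  assumes H: "comm_group H" and \<phi>: "\<phi> \<in> carrier G \<rightarrow> carrier H"
    and \<psi>: "\<psi> \<in> carrier G \<rightarrow> carrier H" and \<theta>: "\<theta> \<in> carrier G \<rightarrow> carrier H"
    and fin: "finite (reidemeister_classes G H [\<phi>, \<psi>, \<theta>])"
  shows "finite (reidemeister_classes G H [\<phi>, \<psi>])"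
    and "finite (reidemeister_classes G H [\<phi>, \<theta>])"
    and "reidemeister_number G H [\<phi>, \<psi>] * reidemeister_number G H [\<phi>, \<theta>] dvd
         reidemeister_number G H [\<phi>, \<psi>, \<theta>]"
proof -
  interpret H: comm_group H by fact
  define o2 o2' o3
    where "o2 = orbit2 G H \<phi> \<psi>" and "o2' = orbit2 G H \<phi> \<theta>" and "o3 = orbit3 G H \<phi> \<psi> \<theta>"
  define B B' A where "B = o2 ` carrier H" and "B' = o2' ` carrier H"
    and "A = o3 ` (carrier H \<times> carrier H)"
  have cls: "reidemeister_classes G H [\<phi>, \<psi>] = B" "reidemeister_classes G H [\<phi>, \<theta>] = B'"
      "reidemeister_classes G H [\<phi>, \<psi>, \<theta>] = A"
    using \<phi> \<psi> \<theta> unfolding A_def B_def B'_def o2_def o2'_def o3_def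
    by (simp_all add: reidemeister_classes_two reidemeister_classes_three H.is_group)
  \<comment> \<open>The pair of projections acts on all elements of a class, so no representative is
    chosen. \<open>tl\<close> of a two-element list is already a singleton tuple, while
    \<open>hd\<close> must be wrapped.\<close>
  define f where "f X = ((\<lambda>l. [hd l]) ` X, tl ` X)" for X :: "'b list set"
  have f: "f (o3 (a, b)) = (o2 a, o2' b)" for a b
    by (simp add: f_def o2_def o2'_def o3_def orbit2_def orbit3_def image_image)
  \<comment> \<open>\<open>a\<close> and \<open>b\<close> vary independently, so every pair of
    classes is hit.\<close>
  have surj: "f ` A = B \<times> B'"
  proof -
    have "f ` A = (\<lambda>(a, b). (o2 a, o2' b)) ` (carrier H \<times> carrier H)"
      unfolding A_def image_image using f by (intro image_cong) auto
    then show ?thesis by (auto simp: B_def B'_def)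
  qed
  \<comment> \<open>Coordinatewise translation by \<open>l\<close>; \<open>map2\<close> serves
    tuples of both lengths.\<close>
  define T where "T l = (`) (map2 (\<otimes>\<^bsub>H\<^esub>) l)" for l :: "'b list"
  \<comment> \<open>Commutativity of \<open>H\<close> enters here: \<open>c\<close> moves past
    \<open>\<phi> z\<close>, so translations send orbits to orbits. \<open>w\<close> stands for
    \<open>\<psi> z\<close> or \<open>\<theta> z\<close>.\<close>
  have comm: "\<phi> z \<otimes>\<^bsub>H\<^esub> (c \<otimes>\<^bsub>H\<^esub> a) \<otimes>\<^bsub>H\<^esub> inv\<^bsub>H\<^esub> w = c \<otimes>\<^bsub>H\<^esub> (\<phi> z \<otimes>\<^bsub>H\<^esub> a \<otimes>\<^bsub>H\<^esub> inv\<^bsub>H\<^esub> w)"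
    if "z \<in> carrier G" "c \<in> carrier H" "a \<in> carrier H" "w \<in> carrier H" for z c a w
    using that \<phi> by (auto simp: H.m_ac Pi_iff)
  have T2: "T [c] (o2 a) = o2 (c \<otimes>\<^bsub>H\<^esub> a)" "T [c] (o2' a) = o2' (c \<otimes>\<^bsub>H\<^esub> a)"
    if "c \<in> carrier H" "a \<in> carrier H" for c a
    using that \<psi> \<theta> unfolding T_def o2_def o2'_def orbit2_def image_image
    by (intro image_cong; auto simp: comm Pi_iff)+
  have T3: "T [c, d] (o3 (a, b)) = o3 (c \<otimes>\<^bsub>H\<^esub> a, d \<otimes>\<^bsub>H\<^esub> b)"
    if "c \<in> carrier H" "a \<in> carrier H" "d \<in> carrier H" "b \<in> carrier H" for a b c d
    using that \<psi> \<theta> unfolding T_def o3_def orbit3_def image_image case_prod_conv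
    by (intro image_cong) (auto simp: comm Pi_iff)
  have finA: "finite A" using fin by (simp add: cls)
  have finBB: "finite (B \<times> B')" using finA unfolding surj[symmetric] by (rule finite_imageI)
  \<comment> \<open>Nonemptiness lets finiteness pass from the product to each factor.\<close>
  have ne: "B \<noteq> {}" "B' \<noteq> {}" by (auto simp: B_def B'_def)
  show "finite (reidemeister_classes G H [\<phi>, \<psi>])" "finite (reidemeister_classes G H [\<phi>, \<theta>])"
    using finBB ne by (auto simp: cls finite_cartesian_product_iff)
  have "card (B \<times> B') dvd card A"
  proof (rule card_dvd_card_if_fibres_le[OF finA surj])
    fix P P' assume "P \<in> B \<times> B'" "P' \<in> B \<times> B'"
    then obtain a b a' b' where P: "P = (o2 a, o2' b)" "P' = (o2 a', o2' b')"
      and ab: "a \<in> carrier H" "b \<in> carrier H" "a' \<in> carrier H" "b' \<in> carrier H"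
      by (auto simp: B_def B'_def)
    \<comment> \<open>The translation taking \<open>(a, b)\<close> to \<open>(a', b')\<close>; it
      carries the fibre over \<open>P\<close> into the fibre over \<open>P'\<close>, and translating
      by the inverses undoes it.\<close>
    define c d where "c = a' \<otimes>\<^bsub>H\<^esub> inv\<^bsub>H\<^esub> a" and "d = b' \<otimes>\<^bsub>H\<^esub> inv\<^bsub>H\<^esub> b"
    have cd: "c \<in> carrier H" "d \<in> carrier H" "c \<otimes>\<^bsub>H\<^esub> a = a'" "d \<otimes>\<^bsub>H\<^esub> b = b'"
      using ab by (auto simp: c_def d_def H.m_assoc)
    show "card {X \<in> A. f X = P} \<le> card {X \<in> A. f X = P'}"
    proof (rule card_inj_on_le)
      show "inj_on (T [c, d]) {X \<in> A. f X = P}"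
      proof (rule inj_on_inverseI)
        fix X assume "X \<in> {X \<in> A. f X = P}"
        then show "T [inv\<^bsub>H\<^esub> c, inv\<^bsub>H\<^esub> d] (T [c, d] X) = X"
          using cd by (auto simp: A_def T3 simp flip: H.m_assoc)
      qed
      show "T [c, d] ` {X \<in> A. f X = P} \<subseteq> {X \<in> A. f X = P'}"
      proof (rule image_subsetI)
        fix X assume "X \<in> {X \<in> A. f X = P}"
        then have "X \<in> A" and fX: "f X = P" by simp_all
        then obtain u v where X: "X = o3 (u, v)" and uv: "u \<in> carrier H" "v \<in> carrier H"
          by (auto simp: A_def)
        \<comment> \<open>Lying over \<open>P\<close> gives only equal orbits of \<open>u\<close>
          and \<open>a\<close>, not \<open>u = a\<close>, so the translation is applied to the
          orbits themselves.\<close>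
        have "T [c] (o2 u) = T [c] (o2 a)" "T [d] (o2' v) = T [d] (o2' b)"
          using fX by (simp_all add: X f P)
        then have "o2 (c \<otimes>\<^bsub>H\<^esub> u) = o2 a'" "o2' (d \<otimes>\<^bsub>H\<^esub> v) = o2' b'"
          using uv ab cd by (simp_all add: T2)
        then show "T [c, d] X \<in> {X \<in> A. f X = P'}"
          using uv cd by (auto simp: X T3 f P A_def)
      qed
      show "finite {X \<in> A. f X = P'}" using finA by simp
    qed
  qed
  then show "reidemeister_number G H [\<phi>, \<psi>] * reidemeister_number G H [\<phi>, \<theta>] dvd
      reidemeister_number G H [\<phi>, \<psi>, \<theta>]"
    by (simp add: reidemeister_number_def cls card_cartesian_product)
qed

theorem proposition3:
  fixes f1 f2 f3 :: "complex \<times> complex \<Rightarrow> complex"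
    and x0 :: "complex \<times> complex" and y0 :: complex
    and w1 w2 w3 :: "real \<Rightarrow> complex"
    and \<phi>1 \<phi>2 \<phi>3 :: "(real \<Rightarrow> complex \<times> complex) set \<Rightarrow> (real \<Rightarrow> complex) set"
  assumes "continuous_on torus f1" "f1 \<in> torus \<rightarrow> circle"
    and "continuous_on torus f2" "f2 \<in> torus \<rightarrow> circle"
    and "continuous_on torus f3" "f3 \<in> torus \<rightarrow> circle"
    and "x0 \<in> torus" "y0 \<in> circle"
    and "path w1" "path_image w1 \<subseteq> circle" "pathstart w1 = y0" "pathfinish w1 = f1 x0"
    and "path w2" "path_image w2 \<subseteq> circle" "pathstart w2 = y0" "pathfinish w2 = f2 x0"
    and "path w3" "path_image w3 \<subseteq> circle" "pathstart w3 = y0" "pathfinish w3 = f3 x0"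
    and "\<phi>1 = induced_hom circle w1 f1"
    and "\<phi>2 = induced_hom circle w2 f2"
    and "\<phi>3 = induced_hom circle w3 f3"
    and "finite (reidemeister_classes (fundamental_group torus x0) (fundamental_group circle y0)
           [\<phi>1, \<phi>2, \<phi>3])"
  shows "finite (reidemeister_classes (fundamental_group torus x0) (fundamental_group circle y0)
           [\<phi>1, \<phi>2]) \<and>
         finite (reidemeister_classes (fundamental_group torus x0) (fundamental_group circle y0)
           [\<phi>1, \<phi>3]) \<and>
         reidemeister_number (fundamental_group torus x0) (fundamental_group circle y0) [\<phi>1, \<phi>2] *
         reidemeister_number (fundamental_group torus x0) (fundamental_group circle y0) [\<phi>1, \<phi>3] dvd
         reidemeister_number (fundamental_group torus x0) (fundamental_group circle y0) [\<phi>1, \<phi>2, \<phi>3]"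
proof -
  let ?G = "fundamental_group torus x0" and ?H = "fundamental_group circle y0"
  \<comment> \<open>The paths \<open>w1\<close>, \<open>w2\<close>, \<open>w3\<close> all start at
    \<open>y0\<close>, so the three homomorphisms share one target group.\<close>
  have hom: "\<phi>1 \<in> hom ?G ?H" "\<phi>2 \<in> hom ?G ?H" "\<phi>3 \<in> hom ?G ?H"
    using assms by (simp_all add: induced_hom_in_hom)
  then have "\<phi>1 \<in> carrier ?G \<rightarrow> carrier ?H" "\<phi>2 \<in> carrier ?G \<rightarrow> carrier ?H"
    "\<phi>3 \<in> carrier ?G \<rightarrow> carrier ?H"
    by (simp_all add: hom_def)
  note reidemeister_number_three[OF comm_group_fundamental_group_sphere[OF \<open>y0 \<in> circle\<close>] this]
  then show ?thesis
    using assms(24) by simp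
qed

end
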